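(* Gromov-hyperbolic groups (finitely generated), and Gromov-hyperbolic connected graphs of bounded degree, have finite twin-width.
   Context: Graphs are simple, undirected, finite or countably infinite. For a finite graph $G$ and a partition $\mathcal P$ of $V(G)$, the quotient graph $G/\mathcal P$ has vertex set $\mathcal P$, with distinct parts $X,Y$ adjacent iff some edge $xy$ of $G$ has $x\in X$, $y\in Y$. A partition sequence of $G$ ($|V(G)|=n$) is a sequence $\mathcal P_n,\dots,\mathcal P_1$ of partitions of $V(G)$, where $\mathcal P_n$ is the partition into singletons, $\mathcal P_1=\{V(G)\}$, and each $\mathcal P_{i-1}$ is obtained from $\mathcal P_i$ by merging two parts; its width is $\max_i\Delta(G/\mathcal P_i)$ ($\Delta$ = maximum degree). The strict twin-width $\mathrm{stww}(G)$ is the minimum width of a partition sequence; for infinite $G$ it is the supremum of $\mathrm{stww}(H)$ over finite induced subgraphs $H$. A graph of bounded degree has finite twin-width if $\mathrm{stww}(G)<\infty$. For a group $\Gamma$ with finite generating set $S$, $\mathrm{Cay}(\Gamma,S)$ is the graph on $\Gamma$ in which distinct $x,y$ are adjacent iff $x^{-1}y\in S\cup S^{-1}$. A finitely generated group has finite twin-width if some (equivalently every) Cayley graph $\mathrm{Cay}(\Gamma,S)$, $S$ finite generating set, has finite strict twin-width. A connected graph is hyperbolic if, with the shortest-path metric (on its geometric realisation), it is hyperbolic in the sense of Gromov; a finitely generated group is hyperbolic if its Cayley graphs are. *)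

theory Defs
  imports
    "HOL-Analysis.Analysis"
    "HOL-Library.Extended_Nat"
    "HOL-Algebra.Generated_Groups"
    "Graph_Theory.Pair_Digraph"
    "Graph_Theory.Digraph_Component"
begin

section \<open>Graphs\<close>

text \<open>
  A simple undirected graph is a pair digraph with symmetric, loop-free arc relation
  (locale \<^locale>\<open>pair_bidirected_digraph\<close>, which allows infinite graphs): the edge $uv$ is
  the pair of arcs $(u,v)$, $(v,u)$.
\<close>

definition neighbours :: "'a pair_pre_digraph \<Rightarrow> 'a \<Rightarrow> 'a set" where
  "neighbours G v = {w. (v, w) \<in> parcs G}"

definition bounded_degree :: "'a pair_pre_digraph \<Rightarrow> bool" where
  "bounded_degree G \<longleftrightarrow>
     (\<exists>d. \<forall>v\<in>pverts G. finite (neighbours G v) \<and> card (neighbours G v) \<le> d)"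

text \<open>Only meaningful for finite nonempty graphs.\<close>

definition max_degree :: "'a pair_pre_digraph \<Rightarrow> nat" where
  "max_degree G = Max ((\<lambda>v. card (neighbours G v)) ` pverts G)"

section \<open>Strict twin-width\<close>

definition quotient_graph :: "'a pair_pre_digraph \<Rightarrow> 'a set set \<Rightarrow> 'a set pair_pre_digraph" where
  "quotient_graph G P =
     \<lparr> pverts = P,
       parcs = {(X, Y). X \<in> P \<and> Y \<in> P \<and> X \<noteq> Y \<and> (\<exists>x\<in>X. \<exists>y\<in>Y. (x, y) \<in> parcs G)} \<rparr>"

text \<open>
  The sequence is the function \<open>P\<close> restricted to the indices \<open>1, \<dots>, card (pverts G)\<close>.
  That its members are partitions of the vertex set is a consequence of the conditions.
\<close>

definition partition_sequence :: "'a pair_pre_digraph \<Rightarrow> (nat \<Rightarrow> 'a set set) \<Rightarrow> bool" where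
  "partition_sequence G P \<longleftrightarrow>
     P (card (pverts G)) = {{v} |v. v \<in> pverts G} \<and>
     P 1 = {pverts G} \<and>
     (\<forall>i\<in>{2..card (pverts G)}. \<exists>X\<in>P i. \<exists>Y\<in>P i.
        X \<noteq> Y \<and> P (i - 1) = insert (X \<union> Y) (P i - {X, Y}))"

definition sequence_width :: "'a pair_pre_digraph \<Rightarrow> (nat \<Rightarrow> 'a set set) \<Rightarrow> nat" where
  "sequence_width G P = Max ((\<lambda>i. max_degree (quotient_graph G (P i))) ` {1..card (pverts G)})"

definition finite_stww :: "'a pair_pre_digraph \<Rightarrow> enat" where
  "finite_stww G = (INF P\<in>{P. partition_sequence G P}. enat (sequence_width G P))"

text \<open>
  The empty graph has no partition sequence, so its \<^const>\<open>finite_stww\<close> would be infinite;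
  hence the supremum ranges over nonempty induced subgraphs only.
\<close>

definition stww :: "'a pair_pre_digraph \<Rightarrow> enat" where
  "stww G =
     (if finite (pverts G) then finite_stww G
      else (SUP H\<in>{H. induced_subgraph (with_proj H) (with_proj G) \<and>
                        finite (pverts H) \<and> pverts H \<noteq> {}}. finite_stww H))"

definition finite_twin_width :: "'a pair_pre_digraph \<Rightarrow> bool" where
  "finite_twin_width G \<longleftrightarrow> stww G < \<infinity>"

section \<open>Hyperbolic graphs\<close>

text \<open>
  Points of the geometric realisation are given by barycentric coordinates: \<open>cell u v\<close> is the
  closed edge $uv$, in which \<open>p\<close> lies at distance \<open>p v\<close> from \<open>u\<close>; \<open>cell v v\<close> consists
  of the vertex \<open>v\<close>.
\<close>

definition cell :: "'a \<Rightarrow> 'a \<Rightarrow> ('a \<Rightarrow> real) set" where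
  "cell u v = {p. (\<forall>x. 0 \<le> p x) \<and> (\<forall>x. x \<notin> {u, v} \<longrightarrow> p x = 0) \<and> (\<Sum>x\<in>{u, v}. p x) = 1}"

definition realisation :: "'a pair_pre_digraph \<Rightarrow> ('a \<Rightarrow> real) set" where
  "realisation G = (\<Union>v\<in>pverts G. cell v v) \<union> (\<Union>(u, v)\<in>parcs G. cell u v)"

text \<open>
  \<open>pl_path G p q l\<close>: there is a piecewise linear path of length \<open>l\<close> from \<open>p\<close> to \<open>q\<close>,
  each linear piece being a segment inside one closed edge (edges have length 1).
\<close>

inductive pl_path :: "'a pair_pre_digraph \<Rightarrow> ('a \<Rightarrow> real) \<Rightarrow> ('a \<Rightarrow> real) \<Rightarrow> real \<Rightarrow> bool"
  for G where
  refl: "p \<in> realisation G \<Longrightarrow> pl_path G p p 0"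
| step: "\<lbrakk>pl_path G p q l; (u, v) \<in> parcs G; q \<in> cell u v; r \<in> cell u v\<rbrakk>
          \<Longrightarrow> pl_path G p r (l + \<bar>q u - r u\<bar>)"

definition realisation_dist :: "'a pair_pre_digraph \<Rightarrow> ('a \<Rightarrow> real) \<Rightarrow> ('a \<Rightarrow> real) \<Rightarrow> real" where
  "realisation_dist G p q = Inf {l. pl_path G p q l}"

definition gromov_product :: "('p \<Rightarrow> 'p \<Rightarrow> real) \<Rightarrow> 'p \<Rightarrow> 'p \<Rightarrow> 'p \<Rightarrow> real" where
  "gromov_product d w x y = (d x w + d y w - d x y) / 2"

definition gromov_hyperbolic :: "'p set \<Rightarrow> ('p \<Rightarrow> 'p \<Rightarrow> real) \<Rightarrow> bool" where
  "gromov_hyperbolic M d \<longleftrightarrow>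
     (\<exists>\<delta>. \<forall>w\<in>M. \<forall>x\<in>M. \<forall>y\<in>M. \<forall>z\<in>M.
        gromov_product d w x z \<ge> min (gromov_product d w x y) (gromov_product d w y z) - \<delta>)"

text \<open>To be used for connected graphs only, where \<^const>\<open>realisation_dist\<close> is a metric.\<close>

definition hyperbolic_graph :: "'a pair_pre_digraph \<Rightarrow> bool" where
  "hyperbolic_graph G \<longleftrightarrow> gromov_hyperbolic (realisation G) (realisation_dist G)"

section \<open>Groups\<close>

definition finite_generating_set :: "('a, 'b) monoid_scheme \<Rightarrow> 'a set \<Rightarrow> bool" where
  "finite_generating_set \<Gamma> S \<longleftrightarrow> finite S \<and> S \<subseteq> carrier \<Gamma> \<and> generate \<Gamma> S = carrier \<Gamma>"

definition cayley_graph :: "('a, 'b) monoid_scheme \<Rightarrow> 'a set \<Rightarrow> 'a pair_pre_digraph" where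
  "cayley_graph \<Gamma> S =
     \<lparr> pverts = carrier \<Gamma>,
       parcs = {(x, y). x \<in> carrier \<Gamma> \<and> y \<in> carrier \<Gamma> \<and> x \<noteq> y \<and>
                        inv\<^bsub>\<Gamma>\<^esub> x \<otimes>\<^bsub>\<Gamma>\<^esub> y \<in> S \<union> (\<lambda>s. inv\<^bsub>\<Gamma>\<^esub> s) ` S} \<rparr>"

text \<open>
  Neither of the following two properties depends on the choice of \<open>S\<close>. Both include finite
  generation.
\<close>

definition hyperbolic_group :: "('a, 'b) monoid_scheme \<Rightarrow> bool" where
  "hyperbolic_group \<Gamma> \<longleftrightarrow>
     (\<exists>S. finite_generating_set \<Gamma> S \<and> hyperbolic_graph (cayley_graph \<Gamma> S))"

definition finite_twin_width_group :: "('a, 'b) monoid_scheme \<Rightarrow> bool" where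
  "finite_twin_width_group \<Gamma> \<longleftrightarrow>
     (\<exists>S. finite_generating_set \<Gamma> S \<and> finite_twin_width (cayley_graph \<Gamma> S))"

end

theory Submission
  imports Defs
begin

text \<open>
  Fix a base vertex \<open>b\<close> and contract a finite induced subgraph by repeatedly merging a vertex that
  is farthest from \<open>b\<close> into a parent, one step closer to \<open>b\<close>. At every stage each part is
  represented by a common ancestor of its members, all ancestors of deep vertices lying on two
  consecutive spheres. Two adjacent vertices have Gromov product about equal to their distance from
  \<open>b\<close>, so by the four-point condition the ancestors that represent them are at bounded
  distance. Hence the degree of the quotient is at most the size of a ball of fixed radius.
\<close>

section \<open>Contracting partitions\<close>

text \<open>An index-free form of a partition sequence of width at most \<open>D\<close>, built from
  the coarsest partition back to \<open>Q\<close>, so that contractions can be constructed by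
  induction. That \<open>Q\<close> is a partition is assumed only where the sequence is
  recovered.\<close>

inductive contractible :: "'a pair_pre_digraph \<Rightarrow> nat \<Rightarrow> 'a set set \<Rightarrow> bool" for G D where
  trivial: "max_degree (quotient_graph G {pverts G}) \<le> D \<Longrightarrow> contractible G D {pverts G}"
| merge: "\<lbrakk>X \<in> Q; Y \<in> Q; X \<noteq> Y; max_degree (quotient_graph G Q) \<le> D;
           contractible G D (insert (X \<union> Y) (Q - {X, Y}))\<rbrakk> \<Longrightarrow> contractible G D Q"

lemma partition_on_merge:
  assumes Q: "partition_on A Q" and "X \<in> Q" "Y \<in> Q"
  shows "partition_on A (insert (X \<union> Y) (Q - {X, Y}))"
proof (rule partition_onI)
  show "\<Union>(insert (X \<union> Y) (Q - {X, Y})) = A"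
    using assms by (auto simp: partition_on_def)
  show "{} \<notin> insert (X \<union> Y) (Q - {X, Y})"
    using assms by (auto simp: partition_on_def)
  show "disjnt p q" if "p \<in> insert (X \<union> Y) (Q - {X, Y})" "q \<in> insert (X \<union> Y) (Q - {X, Y})" "p \<noteq> q" for p q
    using that assms unfolding partition_on_def disjoint_def disjnt_def by blast
qed

text \<open>The union meets the nonempty part \<open>X\<close>, so it is not yet a part and exactly
  one part is lost. This makes the number of parts usable as the index in a partition
  sequence.\<close>

lemma card_merge:
  assumes Q: "partition_on A Q" and "finite Q" "X \<in> Q" "Y \<in> Q" "X \<noteq> Y"
  shows "card Q = Suc (card (insert (X \<union> Y) (Q - {X, Y})))"
proof -
  have ne: "X \<noteq> {}"
    using assms by (auto simp: partition_on_def)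
  have "X \<union> Y \<notin> Q - {X, Y}"
  proof
    assume "X \<union> Y \<in> Q - {X, Y}"
    then have "(X \<union> Y) \<inter> X = {}"
      using assms(3) by (intro disjointD[OF partition_onD2[OF Q]]) simp_all
    with ne show False by auto
  qed
  moreover have "card (Q - {X, Y}) = card Q - 2"
    using assms by (simp add: card_Diff_subset)
  moreover have "2 \<le> card Q"
    using card_mono[of Q "{X, Y}"] assms by simp
  ultimately show ?thesis
    using assms by simp
qed

text \<open>Induction along the contraction, each stage being stored at its number of parts. The
  bound \<open>card Q \<ge> 1\<close> is carried along so that a later stage never overwrites index
  1.\<close>

lemma contractible_sequence:
  assumes "contractible G D Q" "partition_on (pverts G) Q" "finite (pverts G)" "pverts G \<noteq> {}"
  shows "\<exists>P. P (card Q) = Q \<and> P 1 = {pverts G} \<and>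
     (\<forall>i\<in>{2..card Q}. \<exists>X\<in>P i. \<exists>Y\<in>P i. X \<noteq> Y \<and> P (i - 1) = insert (X \<union> Y) (P i - {X, Y})) \<and>
     (\<forall>i\<in>{1..card Q}. max_degree (quotient_graph G (P i)) \<le> D) \<and> card Q \<ge> 1"
  using assms
proof (induction rule: contractible.induct)
  case trivial
  then show ?case by (intro exI[of _ "\<lambda>_. {pverts G}"]) auto
next
  case (merge X Q Y)
  let ?Q = "insert (X \<union> Y) (Q - {X, Y})"
  have fin: "finite Q"
    using finite_elements merge.prems by blast
  have card: "card Q = Suc (card ?Q)"
    using card_merge[OF merge.prems(1) fin] merge.hyps by blast
  have "partition_on (pverts G) ?Q"
    using partition_on_merge merge.hyps merge.prems by blast
  with merge.IH merge.prems obtain P where P: "P (card ?Q) = ?Q" "P 1 = {pverts G}"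
     "\<forall>i\<in>{2..card ?Q}. \<exists>X\<in>P i. \<exists>Y\<in>P i. X \<noteq> Y \<and> P (i - 1) = insert (X \<union> Y) (P i - {X, Y})"
     "\<forall>i\<in>{1..card ?Q}. max_degree (quotient_graph G (P i)) \<le> D" "card ?Q \<ge> 1"
    by blast
  \<comment> \<open>The finer partition goes one index above the sequence already built, whose
    values stay untouched.\<close>
  define P' where "P' = P(card Q := Q)"
  have old: "P' i = P i" if "i \<le> card ?Q" for i
    using that card by (simp add: P'_def)
  have new: "P' (card Q) = Q"
    by (simp add: P'_def)
  have "\<exists>X\<in>P' i. \<exists>Y\<in>P' i. X \<noteq> Y \<and> P' (i - 1) = insert (X \<union> Y) (P' i - {X, Y})"
    if "i \<in> {2..card Q}" for i
  proof (cases "i = card Q")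
    case True
    have "P' (i - 1) = ?Q"
      using True card P(1) old[of "card ?Q"] by simp
    moreover have "P' i = Q"
      using True new by simp
    ultimately show ?thesis
      using merge.hyps(1-3) by auto
  next
    case False
    then have "i \<in> {2..card ?Q}" "P' i = P i" "P' (i - 1) = P (i - 1)"
      using that card by (auto intro!: old)
    then show ?thesis using P(3) by simp
  qed
  moreover have "max_degree (quotient_graph G (P' i)) \<le> D" if "i \<in> {1..card Q}" for i
  proof (cases "i = card Q")
    case True
    then show ?thesis using new merge.hyps(4) by simp
  next
    case False
    then have "i \<in> {1..card ?Q}" "P' i = P i"
      using that card by (auto intro!: old)
    then show ?thesis using P(4) by simp
  qed
  moreover have "P' 1 = {pverts G}"
    using old P(2,5) by simp
  moreover have "card Q \<ge> 1"
    using fin merge.hyps(1) by (auto simp: Suc_le_eq card_gt_0_iff)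
  ultimately show ?case
    using new by (intro exI[of _ P'] conjI ballI)
qed

lemma finite_stww_le_contractible:
  assumes "contractible G D ((\<lambda>v. {v}) ` pverts G)" "finite (pverts G)" "pverts G \<noteq> {}"
  shows "finite_stww G \<le> enat D"
proof -
  have card: "card ((\<lambda>v. {v}) ` pverts G) = card (pverts G)"
    by (simp add: card_image)
  from contractible_sequence[OF assms(1) partition_on_singletons assms(2,3), unfolded card]
  obtain P where P: "P (card (pverts G)) = (\<lambda>v. {v}) ` pverts G" "P 1 = {pverts G}"
     "\<forall>i\<in>{2..card (pverts G)}. \<exists>X\<in>P i. \<exists>Y\<in>P i. X \<noteq> Y \<and> P (i - 1) = insert (X \<union> Y) (P i - {X, Y})"
     "\<forall>i\<in>{1..card (pverts G)}. max_degree (quotient_graph G (P i)) \<le> D" "card (pverts G) \<ge> 1"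
    by (elim exE conjE) (rule that; assumption)
  have "(\<lambda>v. {v}) ` pverts G = {{v} |v. v \<in> pverts G}"
    by auto
  then have "partition_sequence G P"
    using P by (simp add: partition_sequence_def)
  moreover have "sequence_width G P \<le> D"
    unfolding sequence_width_def using P(4,5) by (intro Max.boundedI) auto
  ultimately show ?thesis
    unfolding finite_stww_def by (intro INF_lower2[of P]) auto
qed

section \<open>Partitions into the fibres of a map\<close>

text \<open>A stage of the contraction is encoded by a map to representatives. Ranging over attained
  values only keeps the empty set out.\<close>

definition fibres :: "'a set \<Rightarrow> ('a \<Rightarrow> 'b) \<Rightarrow> 'a set set" where
  "fibres A r = (\<lambda>w. {x \<in> A. r x = w}) ` (r ` A)"

lemma fibres_id: "fibres A (\<lambda>x. x) = (\<lambda>v. {v}) ` A"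
  unfolding fibres_def by auto

lemma fibres_const: "A \<noteq> {} \<Longrightarrow> (\<And>x. x \<in> A \<Longrightarrow> r x = c) \<Longrightarrow> fibres A r = {A}"
  unfolding fibres_def by auto

text \<open>If \<open>p\<close> is not yet a value, redirecting \<open>v\<close> to \<open>p\<close>
  only changes the label of a part, not which points share a label.\<close>

lemma fibres_rename:
  fixes r :: "'a \<Rightarrow> 'b"
  assumes "p \<notin> r ` A"
  shows "fibres A (\<lambda>x. if r x = v then p else r x) = fibres A r" (is "fibres A ?s = _")
proof -
  have *: "{y \<in> A. ?s y = ?s x} = {y \<in> A. r y = r x}" if "x \<in> A" for x
    using assms that by (auto simp: image_iff)
  \<comment> \<open>Indexing the fibres by points instead of values removes the labels, so comparing
    them point by point is enough.\<close>
  have fibres_eq: "fibres A t = (\<lambda>x. {y \<in> A. t y = t x}) ` A" for t :: "'a \<Rightarrow> 'b"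
    unfolding fibres_def by (simp add: image_image)
  show ?thesis
    unfolding fibres_eq by (intro image_cong[OF HOL.refl] *)
qed

text \<open>Counterpart of \<open>fibres_rename\<close>: when \<open>p\<close> is already a value,
  the redirection is exactly one merging step.\<close>

lemma fibres_merge:
  assumes "v \<in> r ` A" "p \<in> r ` A" "v \<noteq> p"
  shows "fibres A (\<lambda>x. if r x = v then p else r x) =
     insert ({x \<in> A. r x = v} \<union> {x \<in> A. r x = p})
       (fibres A r - {{x \<in> A. r x = v}, {x \<in> A. r x = p}})" (is "fibres A ?s = insert (?X \<union> ?Y) _")
proof -
  let ?f = "\<lambda>w. if w = v then p else w"
  have "?f ` (r ` A - {v, p}) = (\<lambda>w. w) ` (r ` A - {v, p})"
    by (rule image_cong) auto
  then have f: "?f ` insert v (insert p (r ` A - {v, p})) = insert p (r ` A - {v, p})"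
    by (simp del: if_image_distrib)
  have "?s ` A = ?f ` (r ` A)"
    by (simp only: image_image)
  also have "r ` A = insert v (insert p (r ` A - {v, p}))"
    using assms by blast
  finally have im: "?s ` A = insert p (r ` A - {v, p})"
    unfolding f .
  have p: "{x \<in> A. ?s x = p} = ?X \<union> ?Y"
    by auto
  have w: "{x \<in> A. ?s x = w} = {x \<in> A. r x = w}" if "w \<in> r ` A - {v, p}" for w
    using that by auto
  have "fibres A ?s = insert (?X \<union> ?Y) ((\<lambda>w. {x \<in> A. ?s x = w}) ` (r ` A - {v, p}))"
    unfolding fibres_def im using p by simp
  also have "(\<lambda>w. {x \<in> A. ?s x = w}) ` (r ` A - {v, p}) = (\<lambda>w. {x \<in> A. r x = w}) ` (r ` A - {v, p})"
    using w by (intro image_cong) auto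
  also have "\<dots> = fibres A r - {?X, ?Y}"
  proof -
    \<comment> \<open>Fibres over attained values are nonempty and so determine their value. Hence
      removing two values removes exactly two parts.\<close>
    have inj: "inj_on (\<lambda>w. {x \<in> A. r x = w}) (r ` A)"
    proof (rule inj_onI)
      fix a b assume "a \<in> r ` A" and eq: "{x \<in> A. r x = a} = {x \<in> A. r x = b}"
      then obtain x where "x \<in> {x \<in> A. r x = a}" by auto
      with eq show "a = b" by auto
    qed
    have "(\<lambda>w. {x \<in> A. r x = w}) ` (r ` A - {v, p}) = fibres A r - (\<lambda>w. {x \<in> A. r x = w}) ` {v, p}"
      unfolding fibres_def using assms by (intro inj_on_image_set_diff[OF inj]) auto
    then show ?thesis by simp
  qed
  finally show ?thesis .
qed

text \<open>Treats both outcomes of a redirection alike: a mere renaming leaves the partition as it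
  is, and otherwise one merge is performed.\<close>

lemma contractible_fibres_redirect:
  assumes "v \<in> r ` pverts G" "v \<noteq> p" "max_degree (quotient_graph G (fibres (pverts G) r)) \<le> D"
    and "contractible G D (fibres (pverts G) (\<lambda>x. if r x = v then p else r x))"
  shows "contractible G D (fibres (pverts G) r)"
proof (cases "p \<in> r ` pverts G")
  case False
  then show ?thesis using assms fibres_rename by metis
next
  case True
  let ?F = "\<lambda>w. {x \<in> pverts G. r x = w}"
  have "?F v \<in> fibres (pverts G) r" "?F p \<in> fibres (pverts G) r"
    using assms(1) True by (auto simp: fibres_def)
  moreover have "?F v \<noteq> ?F p"
    using assms(1,2) by auto
  ultimately show ?thesis
    using assms(3) assms(4)[unfolded fibres_merge[OF assms(1) True assms(2)]]
    by (rule contractible.merge)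
qed

section \<open>Graph distance and the realisation\<close>

text \<open>Common setting for Cayley graphs and arbitrary connected graphs.\<close>

locale connected_graph = pair_bidirected_digraph G for G :: "'a pair_pre_digraph" +
  assumes connected_arcs: "\<lbrakk>u \<in> pverts G; v \<in> pverts G\<rbrakk> \<Longrightarrow> (u, v) \<in> (parcs G)\<^sup>*"
begin

definition gdist :: "'a \<Rightarrow> 'a \<Rightarrow> nat" where
  "gdist u v = (LEAST n. (u, v) \<in> parcs G ^^ n)"

lemma arc_sym: "(u, v) \<in> parcs G \<Longrightarrow> (v, u) \<in> parcs G"
  using pair_sym_arcs by (auto simp: symmetric_def dest: symD)

lemma arc_verts: "(u, v) \<in> parcs G \<Longrightarrow> u \<in> pverts G \<and> v \<in> pverts G"
  using arc_fst_in_verts arc_snd_in_verts by force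

lemma arc_neq: "(u, v) \<in> parcs G \<Longrightarrow> u \<noteq> v"
  using pair_no_loops by force

lemma gdist_relpow: "\<lbrakk>u \<in> pverts G; v \<in> pverts G\<rbrakk> \<Longrightarrow> (u, v) \<in> parcs G ^^ gdist u v"
  unfolding gdist_def using connected_arcs rtrancl_imp_relpow by (metis (mono_tags) LeastI_ex)

lemma gdist_le: "(u, v) \<in> parcs G ^^ n \<Longrightarrow> gdist u v \<le> n"
  unfolding gdist_def by (rule Least_le)

lemma gdist_self [simp]: "gdist u u = 0"
  using gdist_le[of u u 0] by simp

lemma gdist_arc: "(u, v) \<in> parcs G \<Longrightarrow> gdist u v \<le> 1"
  by (rule gdist_le) simp

lemma gdist_eq_0: "\<lbrakk>u \<in> pverts G; v \<in> pverts G; gdist u v = 0\<rbrakk> \<Longrightarrow> u = v"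
  using gdist_relpow[of u v] by simp

lemma gdist_triangle:
  "\<lbrakk>u \<in> pverts G; v \<in> pverts G; w \<in> pverts G\<rbrakk> \<Longrightarrow> gdist u w \<le> gdist u v + gdist v w"
  using gdist_relpow[of u v] gdist_relpow[of v w] by (intro gdist_le) (auto simp: relpow_add)

lemma relpow_sym: "(u, v) \<in> parcs G ^^ n \<Longrightarrow> (v, u) \<in> parcs G ^^ n"
proof (induction n arbitrary: v)
  case (Suc n)
  then obtain w where "(u, w) \<in> parcs G ^^ n" "(w, v) \<in> parcs G" by auto
  with Suc.IH arc_sym show ?case by (meson relpow_Suc_I2)
qed simp

lemma gdist_sym: "gdist u v = gdist v u"
  unfolding gdist_def using relpow_sym by metis

text \<open>The last vertex before \<open>v\<close> on a shortest walk: the walk bounds its distance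
  from above, the triangle inequality from below.\<close>

lemma gdist_parent:
  assumes "u \<in> pverts G" "v \<in> pverts G" "gdist u v = Suc n"
  obtains p where "(p, v) \<in> parcs G" "gdist u p = n"
proof -
  have "(u, v) \<in> parcs G ^^ Suc n"
    using gdist_relpow assms by metis
  then obtain p where p: "(u, p) \<in> parcs G ^^ n" "(p, v) \<in> parcs G" by auto
  have "gdist u v \<le> gdist u p + gdist p v"
    using p arc_verts assms by (intro gdist_triangle) auto
  with gdist_le[OF p(1)] gdist_arc[OF p(2)] assms that p show ?thesis by force
qed

text \<open>The function \<open>gdist u\<close>, extended linearly to the closed edges, is 1-Lipschitz along paths.\<close>

definition potential :: "'a \<Rightarrow> ('a \<Rightarrow> real) \<Rightarrow> real" where
  "potential u p = (\<Sum>x | p x \<noteq> 0. real (gdist u x) * p x)"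

lemma potential_cell:
  assumes "p \<in> cell a b" "a \<noteq> b"
  shows "potential u p = real (gdist u a) * p a + real (gdist u b) * p b"
proof -
  have "potential u p = (\<Sum>x\<in>{a, b}. real (gdist u x) * p x)"
    unfolding potential_def using assms by (intro sum.mono_neutral_left) (auto simp: cell_def)
  then show ?thesis using assms(2) by simp
qed

lemma potential_vertex: "potential u (indicator {v}) = real (gdist u v)"
proof -
  have "{x. indicator {v} x \<noteq> (0 :: real)} = {v}"
    by (auto simp: indicator_def)
  then show ?thesis by (simp add: potential_def)
qed

text \<open>On an edge the slope of the potential is the difference of the distances from
  \<open>u\<close> to its two ends, hence at most 1 in absolute value. This bounds the length of
  every path from below.\<close>

lemma pl_path_potential:
  assumes "pl_path G p q l" "u \<in> pverts G"
  shows "potential u q \<le> potential u p + l"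
  using assms
proof (induction rule: pl_path.induct)
  case (step p q l a b r)
  let ?d = "\<lambda>x. real (gdist u x)"
  have ab: "a \<noteq> b" "a \<in> pverts G" "b \<in> pverts G"
    using step arc_neq arc_verts by blast+
  have sums: "q a + q b = 1" "r a + r b = 1"
    using step ab by (auto simp: cell_def)
  have "gdist u a \<le> gdist u b + 1" "gdist u b \<le> gdist u a + 1"
    using gdist_triangle[of u b a] gdist_triangle[of u a b] gdist_arc[of a b] gdist_sym[of a b]
      step ab by auto
  then have diff: "\<bar>?d a - ?d b\<bar> \<le> 1" by linarith
  have b: "q b = 1 - q a" "r b = 1 - r a"
    using sums by linarith+
  \<comment> \<open>Eliminating the coordinate at \<open>b\<close> turns the increment into slope
    times displacement.\<close>
  have "potential u r - potential u q = (?d a - ?d b) * (r a - q a)"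
    unfolding potential_cell[OF step.hyps(3) ab(1)] potential_cell[OF step.hyps(4) ab(1)] b
    by (simp add: algebra_simps)
  also have "\<dots> \<le> \<bar>?d a - ?d b\<bar> * \<bar>r a - q a\<bar>"
    by (metis abs_ge_self abs_mult)
  also have "\<dots> \<le> \<bar>q a - r a\<bar>"
    using mult_right_mono[OF diff, of "\<bar>r a - q a\<bar>"] by (simp add: abs_minus_commute)
  finally show ?case using step by simp
qed simp

lemma vertex_cell: "a \<noteq> b \<Longrightarrow> indicator {a} \<in> cell a b \<and> indicator {b} \<in> cell a b"
  by (auto simp: cell_def)

lemma vertex_realisation:
  assumes "v \<in> pverts G"
  shows "indicator {v} \<in> realisation G"
proof -
  have "indicator {v} \<in> cell v v"
    by (simp add: cell_def)
  with assms show ?thesis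
    unfolding realisation_def by blast
qed

lemma pl_path_relpow:
  assumes "(u, v) \<in> parcs G ^^ n" "u \<in> pverts G"
  shows "pl_path G (indicator {u}) (indicator {v}) (real n)"
  using assms
proof (induction n arbitrary: v)
  case 0
  then show ?case using pl_path.refl vertex_realisation by auto
next
  case (Suc n)
  then obtain w where w: "(u, w) \<in> parcs G ^^ n" "(w, v) \<in> parcs G" by auto
  have "w \<noteq> v" using w arc_neq by blast
  with pl_path.step[OF Suc.IH[OF w(1) Suc.prems(2)] w(2), of "indicator {v}"] vertex_cell[of w v]
  show ?case by (simp add: add.commute)
qed

text \<open>The infimum is attained: a shortest walk is a path of this length, and the potential,
  which is 0 at \<open>u\<close>, shows that no path is shorter.\<close>

lemma realisation_dist_vertices:
  assumes "u \<in> pverts G" "v \<in> pverts G"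
  shows "realisation_dist G (indicator {u}) (indicator {v}) = real (gdist u v)"
  unfolding realisation_dist_def
proof (rule cInf_eq_minimum)
  show "real (gdist u v) \<in> {l. pl_path G (indicator {u}) (indicator {v}) l}"
    using pl_path_relpow gdist_relpow assms by simp
  show "real (gdist u v) \<le> l" if "l \<in> {l. pl_path G (indicator {u}) (indicator {v}) l}" for l
    using that pl_path_potential[of "indicator {u}" "indicator {v}" l u] assms
    by (simp add: potential_vertex)
qed

section \<open>Hyperbolicity and the degrees of the quotients\<close>

lemma hyperbolic_graph_gdist:
  assumes "hyperbolic_graph G"
  obtains \<delta> where "\<delta> \<ge> 0" "\<And>w x y z. \<lbrakk>w \<in> pverts G; x \<in> pverts G; y \<in> pverts G; z \<in> pverts G\<rbrakk> \<Longrightarrow>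
      gromov_product (\<lambda>u v. real (gdist u v)) w x z \<ge>
        min (gromov_product (\<lambda>u v. real (gdist u v)) w x y)
            (gromov_product (\<lambda>u v. real (gdist u v)) w y z) - \<delta>"
proof -
  obtain \<delta> where \<delta>: "\<forall>w\<in>realisation G. \<forall>x\<in>realisation G. \<forall>y\<in>realisation G. \<forall>z\<in>realisation G.
        gromov_product (realisation_dist G) w x z \<ge>
          min (gromov_product (realisation_dist G) w x y) (gromov_product (realisation_dist G) w y z) - \<delta>"
    using assms by (auto simp: hyperbolic_graph_def gromov_hyperbolic_def)
  have eq: "gromov_product (realisation_dist G) (indicator {w}) (indicator {x}) (indicator {y}) =
      gromov_product (\<lambda>u v. real (gdist u v)) w x y"
    if "w \<in> pverts G" "x \<in> pverts G" "y \<in> pverts G" for w x y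
    using that by (simp add: gromov_product_def realisation_dist_vertices)
  show thesis
  \<comment> \<open>The definition of hyperbolicity puts no sign on \<delta>; enlarging it to a
    nonnegative number keeps the inequality.\<close>
  proof (rule that[of "max \<delta> 0"])
    fix w x y z assume V: "w \<in> pverts G" "x \<in> pverts G" "y \<in> pverts G" "z \<in> pverts G"
    have "gromov_product (realisation_dist G) (indicator {w}) (indicator {x}) (indicator {z}) \<ge>
        min (gromov_product (realisation_dist G) (indicator {w}) (indicator {x}) (indicator {y}))
            (gromov_product (realisation_dist G) (indicator {w}) (indicator {y}) (indicator {z})) - \<delta>"
      using \<delta> V vertex_realisation by blast
    then show "gromov_product (\<lambda>u v. real (gdist u v)) w x z \<ge>
        min (gromov_product (\<lambda>u v. real (gdist u v)) w x y)
            (gromov_product (\<lambda>u v. real (gdist u v)) w y z) - max \<delta> 0"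
      unfolding eq[OF V(1,2,4)] eq[OF V(1,2,3)] eq[OF V(1,3,4)] by linarith
  qed simp
qed

text \<open>Since \<open>a\<close> and \<open>b\<close> lie on geodesics from \<open>c\<close> to
  \<open>x\<close> and \<open>y\<close>, the products of \<open>a\<close> with \<open>x\<close> and
  of \<open>y\<close> with \<open>b\<close> are their distances from \<open>c\<close>. The
  four-point condition is applied twice along the chain \<open>a\<close>, \<open>x\<close>,
  \<open>y\<close>, \<open>b\<close>.\<close>

lemma gdist_ancestors_bounded:
  assumes "hyperbolic_graph G"
  obtains C where "\<And>c x y a b. \<lbrakk>c \<in> pverts G; (x, y) \<in> parcs G; a \<in> pverts G; b \<in> pverts G;
      gdist c x = gdist c a + gdist a x; gdist c y = gdist c b + gdist b y;
      gdist c a \<le> Suc (gdist c b); gdist c b \<le> Suc (gdist c a)\<rbrakk> \<Longrightarrow> gdist a b \<le> C"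
proof -
  let ?g = "gromov_product (\<lambda>u v. real (gdist u v))"
  obtain \<delta> where \<delta>: "\<delta> \<ge> 0" "\<And>w x y z. \<lbrakk>w \<in> pverts G; x \<in> pverts G; y \<in> pverts G; z \<in> pverts G\<rbrakk> \<Longrightarrow>
      ?g w x z \<ge> min (?g w x y) (?g w y z) - \<delta>"
    using hyperbolic_graph_gdist[OF assms] by blast
  show thesis
  \<comment> \<open>With \<open>A\<close> and \<open>B\<close> the distances of \<open>a\<close> and
    \<open>b\<close> from \<open>c\<close>, their product is at least (A + B - 1)/2 - 2\<delta>, and
    their distance is A + B minus twice that product.\<close>
  proof (rule that[of "nat \<lceil>1 + 4 * \<delta>\<rceil>"])
    fix c x y a b
    assume V: "c \<in> pverts G" "a \<in> pverts G" "b \<in> pverts G" and xy: "(x, y) \<in> parcs G"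
      and x: "gdist c x = gdist c a + gdist a x" and y: "gdist c y = gdist c b + gdist b y"
      and lev: "gdist c a \<le> Suc (gdist c b)" "gdist c b \<le> Suc (gdist c a)"
    have xyV: "x \<in> pverts G" "y \<in> pverts G"
      using arc_verts xy by auto
    define A B where "A = real (gdist c a)" and "B = real (gdist c b)"
    have AB: "A \<le> B + 1" "B \<le> A + 1"
      using lev by (auto simp: A_def B_def)
    have ax: "?g c a x = A"
      using x by (simp add: gromov_product_def A_def gdist_sym[of _ c])
    have yb: "?g c y b = B"
      using y by (simp add: gromov_product_def B_def gdist_sym[of _ c] gdist_sym[of y b])
    have "real (gdist x y) \<le> 1" "A \<le> real (gdist c x)" "B \<le> real (gdist c y)"
      using gdist_arc[OF xy] x y by (auto simp: A_def B_def)
    then have "?g c x y \<ge> (A + B - 1) / 2"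
      by (simp add: gromov_product_def gdist_sym[of _ c])
    \<comment> \<open>The levels differ by at most 1, so \<open>A\<close> and \<open>B\<close>
      themselves are at least (A + B - 1)/2 and the minimum loses nothing.\<close>
    then have "min A (?g c x y) \<ge> (A + B - 1) / 2"
      using AB by auto
    then have "?g c a y \<ge> (A + B - 1) / 2 - \<delta>"
      using \<delta>(2)[of c a x y] V xyV unfolding ax by linarith
    moreover have "B \<ge> (A + B - 1) / 2 - \<delta>"
      using AB \<delta>(1) by (simp add: field_simps)
    ultimately have "min (?g c a y) B \<ge> (A + B - 1) / 2 - \<delta>"
      by simp
    then have "?g c a b \<ge> (A + B - 1) / 2 - 2 * \<delta>"
      using \<delta>(2)[of c a y b] V xyV unfolding yb by linarith
    then have "real (gdist a b) \<le> 1 + 4 * \<delta>"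
      by (simp add: gromov_product_def A_def B_def gdist_sym[of _ c] field_simps)
    then show "gdist a b \<le> nat \<lceil>1 + 4 * \<delta>\<rceil>"
      by linarith
  qed
qed

section \<open>Balls and the degrees of fibre quotients\<close>

lemma ball_bounded:
  assumes "bounded_degree G"
  shows "\<exists>K. \<forall>w\<in>pverts G. finite {v \<in> pverts G. gdist w v \<le> n} \<and> card {v \<in> pverts G. gdist w v \<le> n} \<le> K"
proof (induction n)
  case 0
  have "finite {v \<in> pverts G. gdist w v \<le> 0} \<and> card {v \<in> pverts G. gdist w v \<le> 0} \<le> 1"
    if "w \<in> pverts G" for w
  proof -
    have "{v \<in> pverts G. gdist w v \<le> 0} \<subseteq> {w}"
      using that gdist_eq_0 by auto
    then show ?thesis
      using card_mono[of "{w}"] finite_subset[of _ "{w}"] by simp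
  qed
  then show ?case by blast
next
  case (Suc n)
  then obtain K where K: "\<And>w. w \<in> pverts G \<Longrightarrow> finite {v \<in> pverts G. gdist w v \<le> n}"
    "\<And>w. w \<in> pverts G \<Longrightarrow> card {v \<in> pverts G. gdist w v \<le> n} \<le> K" by blast
  obtain d where d: "\<And>v. v \<in> pverts G \<Longrightarrow> finite (neighbours G v)"
     "\<And>v. v \<in> pverts G \<Longrightarrow> card (neighbours G v) \<le> d"
    using assms by (auto simp: bounded_degree_def)
  have "finite {v \<in> pverts G. gdist w v \<le> Suc n} \<and> card {v \<in> pverts G. gdist w v \<le> Suc n} \<le> K + K * d"
    if w: "w \<in> pverts G" for w
  proof -
    let ?B = "{v \<in> pverts G. gdist w v \<le> n}"
    \<comment> \<open>A vertex at distance exactly \<open>Suc n\<close> is a neighbour of its parent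
      in the smaller ball, which gives the bound \<open>K + K * d\<close>.\<close>
    have sub: "{v \<in> pverts G. gdist w v \<le> Suc n} \<subseteq> ?B \<union> (\<Union>p\<in>?B. neighbours G p)"
    proof
      fix v assume v: "v \<in> {v \<in> pverts G. gdist w v \<le> Suc n}"
      show "v \<in> ?B \<union> (\<Union>p\<in>?B. neighbours G p)"
      proof (cases "gdist w v = Suc n")
        case True
        obtain p where "(p, v) \<in> parcs G" "gdist w p = n"
          using gdist_parent[OF w _ True] v by blast
        then show ?thesis using arc_verts by (auto simp: neighbours_def)
      qed (use v in auto)
    qed
    have fin: "finite (?B \<union> (\<Union>p\<in>?B. neighbours G p))"
      using K(1)[OF w] d(1) by auto
    have "card (\<Union>p\<in>?B. neighbours G p) \<le> (\<Sum>p\<in>?B. card (neighbours G p))"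
      using K(1)[OF w] by (rule card_UN_le)
    also have "\<dots> \<le> (\<Sum>p\<in>?B. d)"
      using d(2) by (intro sum_mono) auto
    also have "\<dots> \<le> K * d"
      using K(2)[OF w] by simp
    finally have "card (?B \<union> (\<Union>p\<in>?B. neighbours G p)) \<le> K + K * d"
      using card_Un_le[of ?B "\<Union>p\<in>?B. neighbours G p"] K(2)[OF w] by linarith
    with sub fin show ?thesis
      by (meson card_mono finite_subset le_trans)
  qed
  then show ?case by blast
qed

text \<open>A part is determined by its representative, and adjacent parts have representatives
  within \<open>C\<close>, so a ball counts the neighbours. Distances are taken in \<open>G\<close>,
  since representatives may lie outside \<open>H\<close>.\<close>

lemma max_degree_fibres:
  assumes fin: "finite (pverts H)" "pverts H \<noteq> {}"
    and r: "\<And>x. x \<in> pverts H \<Longrightarrow> r x \<in> pverts G"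
    and near: "\<And>x y. \<lbrakk>x \<in> pverts H; y \<in> pverts H; (x, y) \<in> parcs H\<rbrakk> \<Longrightarrow> gdist (r x) (r y) \<le> C"
    and ball: "\<And>w. w \<in> pverts G \<Longrightarrow> finite {v \<in> pverts G. gdist w v \<le> C}"
      "\<And>w. w \<in> pverts G \<Longrightarrow> card {v \<in> pverts G. gdist w v \<le> C} \<le> K"
  shows "max_degree (quotient_graph H (fibres (pverts H) r)) \<le> K"
proof -
  let ?Q = "fibres (pverts H) r" and ?F = "\<lambda>w. {x \<in> pverts H. r x = w}"
  have "card (neighbours (quotient_graph H ?Q) X) \<le> K" if X: "X \<in> ?Q" for X
  proof -
    obtain w where w: "X = ?F w" "w \<in> r ` pverts H"
      using X by (auto simp: fibres_def)
    then have wG: "w \<in> pverts G"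
      using r by auto
    have "neighbours (quotient_graph H ?Q) X \<subseteq> ?F ` {v \<in> pverts G. gdist w v \<le> C}"
    proof
      fix Y assume "Y \<in> neighbours (quotient_graph H ?Q) X"
      then obtain x y where *: "Y \<in> ?Q" "x \<in> X" "y \<in> Y" "(x, y) \<in> parcs H"
        by (auto simp: neighbours_def quotient_graph_def)
      then obtain v where v: "Y = ?F v" by (auto simp: fibres_def)
      have "r x = w" "r y = v" "x \<in> pverts H" "y \<in> pverts H"
        using * v w by auto
      then show "Y \<in> ?F ` {v \<in> pverts G. gdist w v \<le> C}"
        using near[of x y] r[of y] * v by auto
    qed
    then show ?thesis
      using ball[OF wG] by (meson card_image_le card_mono finite_imageI le_trans)
  qed
  moreover have "finite ?Q" "?Q \<noteq> {}"
    using fin by (auto simp: fibres_def)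
  ultimately show ?thesis
    unfolding max_degree_def by (intro Max.boundedI) (auto simp: quotient_graph_def)
qed

section \<open>Moving representatives towards the base vertex\<close>

text \<open>Sends each vertex of \<open>A\<close> to its representative while the sphere of radius \<open>L\<close>
  around \<open>b\<close> is being contracted into the sphere of radius \<open>L - 1\<close>.\<close>

definition ancestor_map :: "'a \<Rightarrow> 'a set \<Rightarrow> nat \<Rightarrow> ('a \<Rightarrow> 'a) \<Rightarrow> bool" where
  "ancestor_map b A L r \<longleftrightarrow> (\<forall>x\<in>A. r x \<in> pverts G \<and> gdist b x = gdist b (r x) + gdist (r x) x \<and>
     gdist b (r x) \<le> L \<and> (gdist b x < L \<longrightarrow> r x = x) \<and> (L \<le> gdist b x \<longrightarrow> L \<le> Suc (gdist b (r x))))"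

lemma ancestor_mapD:
  assumes "ancestor_map b A L r" "x \<in> A"
  shows "r x \<in> pverts G" "gdist b x = gdist b (r x) + gdist (r x) x" "gdist b (r x) \<le> L"
    "gdist b x < L \<Longrightarrow> r x = x" "L \<le> gdist b x \<Longrightarrow> L \<le> Suc (gdist b (r x))"
  using assms unfolding ancestor_map_def by blast+

text \<open>If \<open>y\<close> is inside the sphere of radius \<open>L\<close>, it represents
  itself, and \<open>r x\<close> is no farther from \<open>b\<close> than \<open>x\<close>.
  Otherwise \<open>r y\<close> has level at least \<open>L - 1\<close>, while \<open>r x\<close> has
  level at most \<open>L\<close>.\<close>

lemma ancestor_map_levels:
  assumes "ancestor_map b A L r" "x \<in> A" "y \<in> A" "(x, y) \<in> parcs G" "b \<in> pverts G"
  shows "gdist b (r x) \<le> Suc (gdist b (r y))"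
proof -
  have "gdist b x \<le> gdist b y + gdist y x"
    using assms arc_verts by (intro gdist_triangle) auto
  then have "gdist b x \<le> Suc (gdist b y)"
    using gdist_arc[of x y] assms(4) gdist_sym[of x y] by simp
  moreover have "gdist b (r x) \<le> L" "gdist b x < L \<Longrightarrow> r x = x" "gdist b y < L \<Longrightarrow> r y = y"
    "L \<le> gdist b y \<Longrightarrow> L \<le> Suc (gdist b (r y))" "gdist b (r x) \<le> gdist b x"
    using ancestor_mapD[OF assms(1,2)] ancestor_mapD[OF assms(1,3)] by linarith+
  ultimately show ?thesis
    by (cases "gdist b y < L") auto
qed

text \<open>The new radius is the level of the farthest representative \<open>v\<close>: it stays
  \<open>L\<close> while that sphere still carries representatives, and drops afterwards.\<close>

lemma ancestor_map_redirect:
  assumes r: "ancestor_map b A L r" and V: "A \<subseteq> pverts G" "b \<in> pverts G"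
    and v: "v \<in> r ` A" and max: "\<And>x. x \<in> A \<Longrightarrow> gdist b (r x) \<le> gdist b v"
    and p: "(p, v) \<in> parcs G" "gdist b v = Suc (gdist b p)"
  shows "ancestor_map b A (gdist b v) (\<lambda>x. if r x = v then p else r x)"
  unfolding ancestor_map_def
proof (intro ballI)
  fix x assume x: "x \<in> A"
  have rx: "r x \<in> pverts G" "gdist b x = gdist b (r x) + gdist (r x) x" "gdist b (r x) \<le> L"
    "gdist b x < L \<Longrightarrow> r x = x" "L \<le> gdist b x \<Longrightarrow> L \<le> Suc (gdist b (r x))" "gdist b (r x) \<le> gdist b v"
    using ancestor_mapD[OF r x] max[OF x] by blast+
  let ?s = "if r x = v then p else r x"
  show "?s \<in> pverts G \<and> gdist b x = gdist b ?s + gdist ?s x \<and> gdist b ?s \<le> gdist b v \<and>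
     (gdist b x < gdist b v \<longrightarrow> ?s = x) \<and> (gdist b v \<le> gdist b x \<longrightarrow> gdist b v \<le> Suc (gdist b ?s))"
  proof (cases "r x = v")
    case True
    have V': "p \<in> pverts G" "v \<in> pverts G" "x \<in> pverts G"
      using p(1) arc_verts V x by auto
    \<comment> \<open>Passing from \<open>b\<close> through \<open>p\<close> and \<open>v\<close> to
      \<open>x\<close> is still shortest, so \<open>p\<close> is again an ancestor of
      \<open>x\<close>.\<close>
    have "gdist b x \<le> gdist b p + gdist p x" "gdist p x \<le> gdist p v + gdist v x"
      using V' V by (auto intro: gdist_triangle)
    then have "gdist b x = gdist b p + gdist p x" "gdist b v \<le> gdist b x"
      using gdist_arc[OF p(1)] rx(2)[unfolded True] p(2) by linarith+
    then show ?thesis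
      using True V' p(2) by simp
  next
    case False
    have "gdist b v \<le> L"
      using v ancestor_mapD(3)[OF r] by blast
    then have "(gdist b x < gdist b v \<longrightarrow> r x = x) \<and> (gdist b v \<le> gdist b x \<longrightarrow> gdist b v \<le> Suc (gdist b (r x)))"
      using rx(4,5) by (cases "gdist b x < L") auto
    then show ?thesis
      unfolding if_not_P[OF False] using rx(1,2,6) by blast
  qed
qed

text \<open>Redirecting a farthest representative to a parent lowers the total distance of the
  representatives from \<open>b\<close>. This sum is the measure, as a mere renaming leaves the
  number of parts unchanged. When it reaches 0, all vertices are represented by
  \<open>b\<close>.\<close>

lemma contractible_ancestor_map:
  assumes H: "finite (pverts H)" "pverts H \<noteq> {}" "pverts H \<subseteq> pverts G" and b: "b \<in> pverts G"
    and deg: "\<And>L r. ancestor_map b (pverts H) L r \<Longrightarrow>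
      max_degree (quotient_graph H (fibres (pverts H) r)) \<le> D"
    and "ancestor_map b (pverts H) L r"
  shows "contractible H D (fibres (pverts H) r)"
  using assms(6)
proof (induction "\<Sum>x\<in>pverts H. gdist b (r x)" arbitrary: L r rule: less_induct)
  case less
  have rG: "r x \<in> pverts G" if "x \<in> pverts H" for x
    using ancestor_mapD(1) less.prems that by blast
  define M where "M = Max ((\<lambda>x. gdist b (r x)) ` pverts H)"
  have M: "gdist b (r x) \<le> M" if "x \<in> pverts H" for x
    unfolding M_def using that H by auto
  have "M \<in> (\<lambda>x. gdist b (r x)) ` pverts H"
    unfolding M_def using H by (intro Max_in) auto
  then obtain x0 where x0: "x0 \<in> pverts H" "gdist b (r x0) = M" by auto
  show ?case
  proof (cases M)
    case 0
    then have "r x = b" if "x \<in> pverts H" for x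
      using that M rG gdist_eq_0 b by (metis le_zero_eq)
    then have "fibres (pverts H) r = {pverts H}"
      using H(2) by (intro fibres_const) auto
    then show ?thesis
      using deg[OF less.prems] contractible.trivial by metis
  next
    case (Suc n)
    then obtain p where p: "(p, r x0) \<in> parcs G" "gdist b p = n"
      using gdist_parent[OF b rG[OF x0(1)]] x0(2) by metis
    let ?s = "\<lambda>x. if r x = r x0 then p else r x"
    have anc: "ancestor_map b (pverts H) (gdist b (r x0)) ?s"
      using less.prems H(3) b M x0 p Suc by (intro ancestor_map_redirect) auto
    have "(\<Sum>x\<in>pverts H. gdist b (?s x)) < (\<Sum>x\<in>pverts H. gdist b (r x))"
      using H(1) x0 p Suc by (intro sum_strict_mono_ex1) auto
    from less.hyps[OF this anc] have "contractible H D (fibres (pverts H) ?s)" .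
    then show ?thesis
      using x0 p arc_neq deg[OF less.prems] by (intro contractible_fibres_redirect[of "r x0" r _ p]) auto
  qed
qed

text \<open>The base vertex is chosen inside \<open>H\<close>, yet \<open>D\<close> is fixed before
  \<open>H\<close>: the bounds on ancestors and on balls are uniform in the base vertex and the
  centre.\<close>

lemma finite_stww_bounded:
  assumes "bounded_degree G" "hyperbolic_graph G"
  obtains D where "\<And>H. \<lbrakk>finite (pverts H); pverts H \<noteq> {}; pverts H \<subseteq> pverts G; parcs H \<subseteq> parcs G\<rbrakk>
    \<Longrightarrow> finite_stww H \<le> enat D"
proof -
  obtain C where C: "\<And>c x y a b. \<lbrakk>c \<in> pverts G; (x, y) \<in> parcs G; a \<in> pverts G; b \<in> pverts G;
      gdist c x = gdist c a + gdist a x; gdist c y = gdist c b + gdist b y;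
      gdist c a \<le> Suc (gdist c b); gdist c b \<le> Suc (gdist c a)\<rbrakk> \<Longrightarrow> gdist a b \<le> C"
    using gdist_ancestors_bounded[OF assms(2)] by blast
  obtain K where K: "\<And>w. w \<in> pverts G \<Longrightarrow> finite {v \<in> pverts G. gdist w v \<le> C}"
    "\<And>w. w \<in> pverts G \<Longrightarrow> card {v \<in> pverts G. gdist w v \<le> C} \<le> K"
    using ball_bounded[OF assms(1), of C] by blast
  show thesis
  proof (rule that[of K])
    fix H :: "'a pair_pre_digraph"
    assume H: "finite (pverts H)" "pverts H \<noteq> {}" "pverts H \<subseteq> pverts G" "parcs H \<subseteq> parcs G"
    then obtain b where b: "b \<in> pverts G" by auto
    have "max_degree (quotient_graph H (fibres (pverts H) r)) \<le> K"
      if r: "ancestor_map b (pverts H) L r" for L r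
    proof (rule max_degree_fibres[OF H(1,2) _ _ K])
      show rG: "r x \<in> pverts G" if "x \<in> pverts H" for x
        using ancestor_mapD(1)[OF r that] .
      fix x y assume xy: "x \<in> pverts H" "y \<in> pverts H" "(x, y) \<in> parcs H"
      then have arcs: "(x, y) \<in> parcs G" "(y, x) \<in> parcs G"
        using H(4) arc_sym by auto
      show "gdist (r x) (r y) \<le> C"
      proof (rule C[OF b arcs(1)])
        show "gdist b x = gdist b (r x) + gdist (r x) x" "gdist b y = gdist b (r y) + gdist (r y) y"
          using ancestor_mapD(2)[OF r] xy by blast+
        show "gdist b (r x) \<le> Suc (gdist b (r y))" "gdist b (r y) \<le> Suc (gdist b (r x))"
          using ancestor_map_levels[OF r] xy arcs b by auto
      qed (use rG xy in auto)
    qed auto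
    \<comment> \<open>A radius strictly beyond all of \<open>H\<close> makes the identity an
      ancestor map, which starts the contraction at the singletons.\<close>
    moreover have "gdist b x < Suc (Max (gdist b ` pverts H))" if "x \<in> pverts H" for x
      using that H(1) by (simp add: less_Suc_eq_le)
    then have "ancestor_map b (pverts H) (Suc (Max (gdist b ` pverts H))) (\<lambda>x. x)"
      unfolding ancestor_map_def using H(3) by (auto simp: less_imp_le leD)
    ultimately have "contractible H K (fibres (pverts H) (\<lambda>x. x))"
      using contractible_ancestor_map[OF H(1-3) b] by blast
    then show "finite_stww H \<le> enat K"
      using H by (intro finite_stww_le_contractible) (auto simp: fibres_id)
  qed
qed

lemma finite_twin_width_hyperbolic:
  assumes "bounded_degree G" "hyperbolic_graph G" "pverts G \<noteq> {}"
  shows "finite_twin_width G"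
proof -
  obtain D where D: "\<And>H. \<lbrakk>finite (pverts H); pverts H \<noteq> {}; pverts H \<subseteq> pverts G; parcs H \<subseteq> parcs G\<rbrakk>
    \<Longrightarrow> finite_stww H \<le> enat D"
    using finite_stww_bounded[OF assms(1,2)] by blast
  \<comment> \<open>If \<open>G\<close> is finite, the bound is applied to \<open>G\<close> itself;
    otherwise to every induced subgraph in the supremum.\<close>
  have "stww G \<le> enat D"
    unfolding stww_def using D assms(3)
    by (auto simp: induced_subgraph_def subgraph_def intro!: SUP_least)
  then show ?thesis
    unfolding finite_twin_width_def by (rule le_less_trans) simp
qed

end

section \<open>Cayley graphs\<close>

context group
begin

lemma cayley_graph_bidirected:
  assumes "S \<subseteq> carrier G"
  shows "pair_bidirected_digraph (cayley_graph G S)"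
proof
  show "symmetric (with_proj (cayley_graph G S))"
    unfolding symmetric_def with_proj_simps
  proof (rule symI)
    fix x y assume "(x, y) \<in> parcs (cayley_graph G S)"
    then have *: "x \<in> carrier G" "y \<in> carrier G" "x \<noteq> y"
      and S: "inv x \<otimes> y \<in> S \<union> (\<lambda>s. inv s) ` S"
      by (auto simp: cayley_graph_def)
    have "inv y \<otimes> x = inv (inv x \<otimes> y)"
      using * by (simp add: inv_mult_group)
    moreover have "inv (inv x \<otimes> y) \<in> S \<union> (\<lambda>s. inv s) ` S"
      using S assms by auto
    ultimately show "(y, x) \<in> parcs (cayley_graph G S)"
      using * by (simp add: cayley_graph_def)
  qed
qed (auto simp: cayley_graph_def)

lemma cayley_graph_connected:
  assumes S: "S \<subseteq> carrier G" "generate G S = carrier G"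
    and xy: "x \<in> carrier G" "y \<in> carrier G"
  shows "(x, y) \<in> (parcs (cayley_graph G S))\<^sup>*"
proof -
  \<comment> \<open>Keeping the starting point arbitrary lets the walks for two factors be
    concatenated at \<open>x \<otimes> g\<close>.\<close>
  have "\<forall>x\<in>carrier G. (x, x \<otimes> g) \<in> (parcs (cayley_graph G S))\<^sup>*" if "g \<in> generate G S" for g
    using that
  proof (induction rule: generate.induct)
    case one
    then show ?case by simp
  next
    case (incl h)
    \<comment> \<open>A generator may be the identity; it gives no arc, since loops are
      excluded.\<close>
    then have "x = x \<otimes> h \<or> (x, x \<otimes> h) \<in> parcs (cayley_graph G S)" if "x \<in> carrier G" for x
      using S that by (auto simp: cayley_graph_def m_assoc[symmetric])
    then show ?case by (metis r_into_rtrancl rtrancl.rtrancl_refl)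
  next
    case (inv h)
    then have "x = x \<otimes> inv h \<or> (x, x \<otimes> inv h) \<in> parcs (cayley_graph G S)" if "x \<in> carrier G" for x
      using S that by (auto simp: cayley_graph_def m_assoc[symmetric])
    then show ?case by (metis r_into_rtrancl rtrancl.rtrancl_refl)
  next
    case (eng g h)
    then have "g \<in> carrier G" "h \<in> carrier G"
      using S by auto
    with eng.IH show ?case
      by (metis m_assoc m_closed rtrancl_trans)
  qed
  moreover have "inv x \<otimes> y \<in> generate G S"
    using S xy by simp
  moreover have "x \<otimes> (inv x \<otimes> y) = y"
    using xy by (simp add: m_assoc[symmetric])
  ultimately show ?thesis
    using xy by metis
qed

lemma cayley_graph_bounded_degree:
  assumes "finite S"
  shows "bounded_degree (cayley_graph G S)"
  unfolding bounded_degree_def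
proof (intro exI ballI)
  fix x assume "x \<in> pverts (cayley_graph G S)"
  then have x: "x \<in> carrier G" by (simp add: cayley_graph_def)
  let ?T = "S \<union> (\<lambda>s. inv s) ` S"
  have sub: "neighbours (cayley_graph G S) x \<subseteq> (\<lambda>t. x \<otimes> t) ` ?T"
  proof
    fix y assume "y \<in> neighbours (cayley_graph G S) x"
    then have "inv x \<otimes> y \<in> ?T" "y = x \<otimes> (inv x \<otimes> y)"
      using x by (auto simp: neighbours_def cayley_graph_def m_assoc[symmetric])
    then show "y \<in> (\<lambda>t. x \<otimes> t) ` ?T" by blast
  qed
  have fin: "finite ?T"
    using assms by simp
  show "finite (neighbours (cayley_graph G S) x) \<and> card (neighbours (cayley_graph G S) x) \<le> card ?T"
    using sub fin by (meson card_image_le card_mono finite_imageI finite_subset le_trans)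
qed

end

theorem proposition4p2:
  fixes \<Gamma> :: "('a, 'b) monoid_scheme" and G :: "'c pair_pre_digraph"
  shows "(group \<Gamma> \<and> hyperbolic_group \<Gamma> \<longrightarrow> finite_twin_width_group \<Gamma>) \<and>
         (pair_bidirected_digraph G \<and> countable (pverts G) \<and>
          Digraph_Component.connected (with_proj G) \<and> bounded_degree G \<and> hyperbolic_graph G
          \<longrightarrow> finite_twin_width G)"
proof (intro conjI impI; elim conjE)
  assume "group \<Gamma>" "hyperbolic_group \<Gamma>"
  then interpret group \<Gamma> by blast
  obtain S where S: "finite_generating_set \<Gamma> S" "hyperbolic_graph (cayley_graph \<Gamma> S)"
    using \<open>hyperbolic_group \<Gamma>\<close> by (auto simp: hyperbolic_group_def)
  then have S': "finite S" "S \<subseteq> carrier \<Gamma>" "generate \<Gamma> S = carrier \<Gamma>"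
    by (auto simp: finite_generating_set_def)
  have verts: "pverts (cayley_graph \<Gamma> S) = carrier \<Gamma>"
    by (simp add: cayley_graph_def)
  interpret cay: connected_graph "cayley_graph \<Gamma> S"
    using cayley_graph_bidirected[OF S'(2)] cayley_graph_connected[OF S'(2,3)] verts
    by (simp add: connected_graph_def connected_graph_axioms_def)
  have "finite_twin_width (cayley_graph \<Gamma> S)"
    using cayley_graph_bounded_degree[OF S'(1)] S(2) verts one_closed
    by (intro cay.finite_twin_width_hyperbolic) auto
  then show "finite_twin_width_group \<Gamma>"
    using S(1) by (auto simp: finite_twin_width_group_def)
next
  assume G: "pair_bidirected_digraph G" and con: "Digraph_Component.connected (with_proj G)"
    and bd: "bounded_degree G" "hyperbolic_graph G"
  interpret pair_bidirected_digraph G by fact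
  \<comment> \<open>The arcs are already symmetric, so the symmetric closure in
    \<open>connected\<close> changes nothing. Strong connectedness also supplies a vertex.\<close>
  have sc: "strongly_connected (with_proj G)"
    using con pair_sym_arcs unfolding connected_def strongly_connected_def
    by (simp add: reachable_mk_symmetric_eq)
  have "(u, v) \<in> (parcs G)\<^sup>*" if "u \<in> pverts G" "v \<in> pverts G" for u v
    using sc that unfolding strongly_connected_def reachable_def
    by (auto dest: rtrancl_on_rtranclI)
  then interpret connected_graph G
    by unfold_locales
  show "finite_twin_width G"
    using bd sc by (intro finite_twin_width_hyperbolic) (auto simp: strongly_connected_def)
qed

end
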